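(* Let $w=(w_k)_{k\ge0}$ be any weight sequence with $w_0>0$ and $w_k>0$ for some $k\ge2$. Suppose that $n\to\infty$ with $n\equiv1\pmod{\mathrm{span}(w)}$, and let $\tau$ be the unique number in $[0,\rho]$ with $\Psi(\tau)=1$ if $\nu\ge1$, and $\tau=\rho$ if $\nu<1$. Then $$\frac1n\log Z_n\to\log\Phi(\tau)-\log\tau=\log\inf_{0\le t<\infty}\frac{\Phi(t)}{t}\in(-\infty,\infty].$$ The limit is finite if $\rho>0$, and $+\infty$ if $\rho=0$.
   Context: A weight sequence is a sequence $w=(w_k)_{k\ge0}$ of nonnegative reals; $\mathrm{span}(w)$ is the largest $d\ge1$ dividing every $k$ with $w_k>0$. $\Phi(t)=\sum_{k\ge0}w_kt^k$, $\rho\in[0,\infty]$ its radius of convergence; for $t$ with $\Phi(t)<\infty$, $\Psi(t)=t\Phi'(t)/\Phi(t)$; if $\Phi(\rho)=\infty$, $\Psi(\rho)=\lim_{t\uparrow\rho}\Psi(t)$; $\nu=\Psi(\rho)$. $Z_n=\sum_T\prod_{v\in T}w_{d^+_T(v)}$, the sum over all ordered rooted trees $T$ with $n$ nodes, where $d^+_T(v)$ is the number of children of $v$. *)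

theory Defs
  imports "HOL-Analysis.Analysis"
begin

datatype ptree = Node "ptree list"

fun tsize :: "ptree \<Rightarrow> nat" where
  "tsize (Node ts) = Suc (sum_list (map tsize ts))"

fun tweight :: "(nat \<Rightarrow> real) \<Rightarrow> ptree \<Rightarrow> real" where
  "tweight w (Node ts) = w (length ts) * prod_list (map (tweight w) ts)"

definition Z :: "(nat \<Rightarrow> real) \<Rightarrow> nat \<Rightarrow> real" where
  "Z w n = (\<Sum>T\<in>{T. tsize T = n}. tweight w T)"

definition span :: "(nat \<Rightarrow> real) \<Rightarrow> nat" where
  "span w = (GREATEST d. d \<ge> 1 \<and> (\<forall>k. w k > 0 \<longrightarrow> d dvd k))"

definition Phi :: "(nat \<Rightarrow> real) \<Rightarrow> real \<Rightarrow> ennreal" where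
  "Phi w t = (\<Sum>k. ennreal (w k * t ^ k))"

definition rho :: "(nat \<Rightarrow> real) \<Rightarrow> ereal" where
  "rho w = conv_radius w"

text \<open>Psi(t) = t Phi'(t) / Phi(t) = (sum k w_k t^k) / Phi(t), for Phi(t) finite.\<close>
definition Psi :: "(nat \<Rightarrow> real) \<Rightarrow> real \<Rightarrow> ennreal" where
  "Psi w t = (\<Sum>k. ennreal (real k * w k * t ^ k)) / Phi w t"

definition nu :: "(nat \<Rightarrow> real) \<Rightarrow> ennreal" where
  "nu w = (if rho w = \<infinity> then Lim at_top (Psi w)
           else if Phi w (real_of_ereal (rho w)) = \<infinity>
             then Lim (at_left (real_of_ereal (rho w))) (Psi w)
           else Psi w (real_of_ereal (rho w)))"

definition PsiX :: "(nat \<Rightarrow> real) \<Rightarrow> real \<Rightarrow> ennreal" where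
  "PsiX w t = (if ereal t = rho w then nu w else Psi w t)"

definition tau :: "(nat \<Rightarrow> real) \<Rightarrow> ereal" where
  "tau w = (if nu w \<ge> 1
            then ereal (THE t. 0 \<le> t \<and> ereal t \<le> rho w \<and> PsiX w t = 1)
            else rho w)"

end

theory Submission
  imports Defs
begin

text \<open>
  Grafting a tree at the leftmost leaf of another gives \<open>Z\<^sub>m Z\<^sub>n \<le> w\<^sub>0 Z\<^bsub>m+n-1\<^esub>\<close>. So if
  \<open>Z\<^bsub>p+1\<^esub> \<ge> w\<^sub>0 c\<^sup>p\<close> for a single \<open>p > 0\<close>, then \<open>Z\<^sub>n\<close> is at least a constant times \<open>c\<^sup>n\<close> for all large
  \<open>n \<equiv> 1\<close> modulo the span. On the other hand, the recursive structure of trees shows that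
  \<open>\<Sum> Z\<^sub>n x\<^sup>n\<close> converges if and only if \<open>x \<Phi>(t) \<le> t\<close> for some \<open>t > 0\<close>: such a \<open>t\<close> bounds all partial
  sums, and conversely the sum itself is such a \<open>t\<close>. Together, the exponential growth rate of
  \<open>Z\<^sub>n\<close> is \<open>inf \<Phi>(t)/t\<close>. The point \<open>\<tau>\<close> is the largest \<open>t\<close> at which the power series
  \<open>\<Sum>\<^bsub>k\<ge>1\<^esub> (k - 1) w\<^sub>k t\<^sup>k\<close> is at most \<open>w\<^sub>0\<close>, and convexity of \<open>\<Phi>(t)/t\<close> in \<open>ln t\<close> shows that the
  infimum is attained there.
\<close>

section \<open>Plane trees\<close>

fun graft :: "ptree \<Rightarrow> ptree \<Rightarrow> ptree" where
  "graft (Node []) U = U"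
| "graft (Node (T # Ts)) U = Node (graft T U # Ts)"

lemma tsize_pos: "tsize T > 0"
  by (cases T) simp

text \<open>The leaf of \<open>T\<close> that makes room for \<open>U\<close> disappears, hence the
  \<open>Suc\<close> here and the factor \<open>w 0\<close> in the weight identity below.\<close>

lemma tsize_graft: "Suc (tsize (graft T U)) = tsize T + tsize U"
  by (induction T U rule: graft.induct) auto

lemma tweight_graft: "w 0 * tweight w (graft T U) = tweight w T * tweight w U"
  by (induction T U rule: graft.induct) (auto simp: algebra_simps)

lemma length_le_sum_list_tsize: "length Ts \<le> sum_list (map tsize Ts)"
  by (induction Ts) (use tsize_pos in \<open>auto simp: Suc_le_eq add_strict_increasing\<close>)

text \<open>Sizes strictly decrease along the leftmost branch, so \<open>tsize U\<close> locates the graft.\<close>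
lemma graft_inject:
  assumes "graft T U = graft T' U'" "tsize U = tsize U'"
  shows "T = T' \<and> U = U'"
  using assms
proof (induction T U arbitrary: T' rule: graft.induct)
  case (1 U)
  have "Suc (tsize U) = tsize T' + tsize U'"
    using tsize_graft[of T' U'] 1 by simp
  then have "tsize T' = 1" using 1 by simp
  \<comment> \<open>The \<open>case\<close> term is the list of children of \<open>T'\<close>; every
    child has size at least 1, so size 1 leaves none.\<close>
  then have "T' = Node []"
    using length_le_sum_list_tsize[of "case T' of Node Ts \<Rightarrow> Ts"] by (cases T') (auto simp del: sum_list_eq_0_iff)
  then show ?case using 1 by simp
next
  case (2 T Ts U)
  show ?case
  proof (cases "(T', U')" rule: graft.cases)
    case 1
    have "tsize (graft (Node (T # Ts)) U) = tsize U" using 2 1 by simp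
    then show ?thesis using tsize_graft[of "Node (T # Ts)" U] tsize_pos[of T] by simp
  next
    case (2 V Vs V')
    then show ?thesis using "2.prems" "2.IH"[of V] by auto
  qed
qed

text \<open>Children have size at least 1, so their sizes and their number are both at most
  \<open>N\<close>. This drives the finiteness induction and the upper half of the recursion for
  \<open>gf_upto\<close>.\<close>

lemma tsize_le_Suc_subset:
  "{T. tsize T \<le> Suc N} \<subseteq> Node ` {Ts. set Ts \<subseteq> {T. tsize T \<le> N} \<and> length Ts \<le> N}"
proof
  fix T assume "T \<in> {T. tsize T \<le> Suc N}"
  moreover obtain Ts where "T = Node Ts" by (cases T)
  ultimately have T: "T = Node Ts" "sum_list (map tsize Ts) \<le> N" by auto
  have "tsize S \<le> N" if "S \<in> set Ts" for S
    using member_le_sum_list[of "tsize S" "map tsize Ts"] that T by auto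
  then show "T \<in> Node ` {Ts. set Ts \<subseteq> {T. tsize T \<le> N} \<and> length Ts \<le> N}"
    using T length_le_sum_list_tsize[of Ts] by auto
qed

lemma finite_tsize_le: "finite {T. tsize T \<le> N}"
proof (induction N)
  case 0
  have "{T. tsize T \<le> 0} = {}" using tsize_pos by (auto simp: not_le)
  then show ?case by (metis finite.emptyI)
next
  case (Suc N)
  then show ?case
    by (intro finite_subset[OF tsize_le_Suc_subset] finite_imageI finite_lists_length_le)
qed

lemma finite_tsize_eq: "finite {T. tsize T = n}"
  by (rule finite_subset[OF _ finite_tsize_le[of n]]) auto

text \<open>A crude counterpart to the inclusion above; any finite bound is good enough, since
  \<open>N\<close> is later sent to infinity.\<close>

lemma tsize_Node_le:
  assumes "set Ts \<subseteq> {T. tsize T \<le> N}" "length Ts \<le> K"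
  shows "tsize (Node Ts) \<le> Suc (K * N)"
proof -
  have "sum_list (map tsize Ts) \<le> length Ts * N"
    using assms(1) by (induction Ts) auto
  also have "\<dots> \<le> K * N" using assms(2) by simp
  finally show ?thesis by simp
qed

lemma sum_prod_list_length_eq:
  fixes f :: "'a \<Rightarrow> 'b::comm_semiring_1"
  assumes "finite A"
  shows "(\<Sum>xs | set xs \<subseteq> A \<and> length xs = n. prod_list (map f xs)) = (\<Sum>a\<in>A. f a) ^ n"
proof (induction n)
  case 0
  have "{xs. set xs \<subseteq> A \<and> length xs = 0} = {[]}" by auto
  then show ?case by simp
next
  case (Suc n)
  let ?L = "\<lambda>n. {xs. set xs \<subseteq> A \<and> length xs = n}"
  have L: "?L (Suc n) = (\<lambda>(x, xs). x # xs) ` (A \<times> ?L n)"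
    by (auto simp: length_Suc_conv image_iff)
  have "(\<Sum>xs\<in>?L (Suc n). prod_list (map f xs)) = (\<Sum>(x, xs)\<in>A \<times> ?L n. f x * prod_list (map f xs))"
    unfolding L by (subst sum.reindex) (auto simp: inj_on_def intro!: sum.cong)
  also have "\<dots> = (\<Sum>a\<in>A. f a) * (\<Sum>xs\<in>?L n. prod_list (map f xs))"
    by (simp add: sum.cartesian_product[symmetric] sum_product)
  finally show ?case using Suc by simp
qed

lemma sum_prod_list_length_le:
  fixes f :: "'a \<Rightarrow> 'b::comm_semiring_1"
  assumes "finite A"
  shows "(\<Sum>xs | set xs \<subseteq> A \<and> length xs \<le> K. c (length xs) * prod_list (map f xs))
       = (\<Sum>k\<le>K. c k * (\<Sum>a\<in>A. f a) ^ k)"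
proof -
  let ?L = "\<lambda>n. {xs. set xs \<subseteq> A \<and> length xs = n}"
  have "{xs. set xs \<subseteq> A \<and> length xs \<le> K} = (\<Union>k\<le>K. ?L k)" by auto
  then have "(\<Sum>xs | set xs \<subseteq> A \<and> length xs \<le> K. c (length xs) * prod_list (map f xs))
    = (\<Sum>k\<le>K. \<Sum>xs\<in>?L k. c (length xs) * prod_list (map f xs))"
    using finite_lists_length_eq[OF assms] by (simp only:) (subst sum.UNION_disjoint, auto)
  also have "\<dots> = (\<Sum>k\<le>K. c k * (\<Sum>xs\<in>?L k. prod_list (map f xs)))"
    by (simp add: sum_distrib_left)
  finally show ?thesis by (simp add: sum_prod_list_length_eq[OF assms])
qed

section \<open>Weighted tree counts and their truncated generating functions\<close>

locale weight_sequence =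
  fixes w :: "nat \<Rightarrow> real"
  assumes nonneg: "w k \<ge> 0"
    and w0: "w 0 > 0"
    and wk: "\<exists>k\<ge>2. w k > 0"
begin

lemma tweight_nonneg: "tweight w T \<ge> 0"
  by (induction T) (auto intro!: mult_nonneg_nonneg nonneg prod_list_nonneg)

lemma Z_nonneg: "Z w n \<ge> 0"
  unfolding Z_def by (intro sum_nonneg tweight_nonneg)

text \<open>Grafting is injective on pairs of trees of prescribed sizes, and the trees outside its
  image have nonnegative weight.\<close>

lemma Z_supermult: "Z w (Suc m) * Z w (Suc n) \<le> w 0 * Z w (Suc (m + n))"
proof -
  let ?S = "\<lambda>n. {T. tsize T = n}"
  let ?A = "?S (Suc m) \<times> ?S (Suc n)"
  have inj: "inj_on (\<lambda>(T, U). graft T U) ?A"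
    by (auto simp: inj_on_def dest: graft_inject)
  have sub: "(\<lambda>(T, U). graft T U) ` ?A \<subseteq> ?S (Suc (m + n))"
  proof clarsimp
    fix T U assume "tsize T = Suc m" "tsize U = Suc n"
    then show "tsize (graft T U) = Suc (m + n)" using tsize_graft[of T U] by simp
  qed
  have "Z w (Suc m) * Z w (Suc n) = (\<Sum>(T, U)\<in>?A. tweight w T * tweight w U)"
    by (simp add: Z_def sum_product sum.cartesian_product)
  also have "\<dots> = w 0 * (\<Sum>(T, U)\<in>?A. tweight w (graft T U))"
    by (simp add: sum_distrib_left tweight_graft[symmetric] case_prod_beta)
  also have "(\<Sum>(T, U)\<in>?A. tweight w (graft T U)) = (\<Sum>T\<in>(\<lambda>(T, U). graft T U) ` ?A. tweight w T)"
    by (subst sum.reindex[OF inj]) (simp add: case_prod_beta)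
  also have "w 0 * \<dots> \<le> w 0 * Z w (Suc (m + n))"
    unfolding Z_def using w0
    by (intro mult_left_mono sum_mono2 finite_tsize_eq sub tweight_nonneg) auto
  finally show ?thesis .
qed

text \<open>Truncating by size keeps this a finite sum, so that no convergence in \<open>x\<close>
  is presupposed.\<close>

definition gf_upto :: "real \<Rightarrow> nat \<Rightarrow> real" where
  "gf_upto x N = (\<Sum>T | tsize T \<le> N. tweight w T * x ^ tsize T)"

lemma gf_upto_eq_Z: "gf_upto x N = (\<Sum>n\<le>N. Z w n * x ^ n)"
proof -
  have "{T. tsize T \<le> N} = (\<Union>n\<le>N. {T. tsize T = n})" by auto
  then have "gf_upto x N = (\<Sum>n\<le>N. \<Sum>T | tsize T = n. tweight w T * x ^ tsize T)"
    unfolding gf_upto_def using finite_tsize_eq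
    by (simp only:) (subst sum.UNION_disjoint, auto)
  then show ?thesis by (simp add: Z_def sum_distrib_right)
qed

lemma tweight_power_Node:
  "tweight w (Node Ts) * x ^ tsize (Node Ts)
     = x * w (length Ts) * prod_list (map (\<lambda>T. tweight w T * x ^ tsize T) Ts)"
proof -
  have "prod_list (map (tweight w) Ts) * x ^ sum_list (map tsize Ts)
    = prod_list (map (\<lambda>T. tweight w T * x ^ tsize T) Ts)"
    by (induction Ts) (simp_all add: power_add mult.assoc mult.left_commute)
  then show ?thesis by (simp add: mult.assoc mult.left_commute)
qed

text \<open>Splitting off the root gives the functional equation \<open>y = x * Phi(y)\<close> of
  the tree series, truncated by \<open>N\<close> in the child sizes and by \<open>K\<close> in the
  root degree.\<close>

lemma sum_Node_lists:
  "(\<Sum>T\<in>Node ` {Ts. set Ts \<subseteq> {T. tsize T \<le> N} \<and> length Ts \<le> K}. tweight w T * x ^ tsize T)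
     = x * (\<Sum>k\<le>K. w k * gf_upto x N ^ k)"
proof -
  let ?L = "{Ts. set Ts \<subseteq> {T. tsize T \<le> N} \<and> length Ts \<le> K}"
  have "(\<Sum>T\<in>Node ` ?L. tweight w T * x ^ tsize T)
      = (\<Sum>Ts\<in>?L. x * w (length Ts) * prod_list (map (\<lambda>T. tweight w T * x ^ tsize T) Ts))"
    by (subst sum.reindex) (auto simp: inj_on_def tweight_power_Node simp del: tweight.simps tsize.simps)
  also have "\<dots> = (\<Sum>k\<le>K. x * w k * gf_upto x N ^ k)"
    unfolding gf_upto_def using sum_prod_list_length_le[OF finite_tsize_le, where c = "\<lambda>k. x * w k"] by simp
  finally show ?thesis by (simp add: sum_distrib_left mult.assoc)
qed

lemma gf_upto_nonneg: "x \<ge> 0 \<Longrightarrow> gf_upto x N \<ge> 0"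
  unfolding gf_upto_def by (intro sum_nonneg mult_nonneg_nonneg tweight_nonneg) auto

text \<open>This inequality and the next are the two halves of the functional equation; truncation
  turns the equality into inclusions of finite sets of trees.\<close>

lemma gf_upto_Suc_le:
  assumes "x \<ge> 0"
  shows "gf_upto x (Suc N) \<le> x * (\<Sum>k\<le>N. w k * gf_upto x N ^ k)"
  unfolding sum_Node_lists[symmetric] gf_upto_def[of x "Suc N"]
  using assms
  by (intro sum_mono2 tsize_le_Suc_subset finite_imageI finite_lists_length_le finite_tsize_le)
     (auto intro!: mult_nonneg_nonneg tweight_nonneg simp del: tweight.simps tsize.simps)

lemma gf_upto_ge:
  assumes "x \<ge> 0"
  shows "x * (\<Sum>k\<le>K. w k * gf_upto x N ^ k) \<le> gf_upto x (Suc (K * N))"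
  unfolding sum_Node_lists[symmetric] gf_upto_def[of x "Suc (K * N)"]
  using assms tsize_Node_le
  by (intro sum_mono2 finite_tsize_le)
     (auto intro!: mult_nonneg_nonneg tweight_nonneg simp del: tweight.simps tsize.simps)

text \<open>For \<open>0 <= y <= t\<close>, \<open>x * Phi(y) <= x * Phi(t) <= t\<close>, so the
  recursion never carries the truncations past \<open>t\<close>.\<close>

lemma gf_upto_le:
  assumes "x \<ge> 0" "t \<ge> 0" "\<And>K. x * (\<Sum>k\<le>K. w k * t ^ k) \<le> t"
  shows "gf_upto x N \<le> t"
proof (induction N)
  case 0
  have "{T. tsize T \<le> 0} = {}" using tsize_pos by (auto simp: not_le)
  then have "gf_upto x 0 = 0" unfolding gf_upto_def by (metis sum.empty)
  then show ?case using assms by simp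
next
  case (Suc N)
  have "gf_upto x (Suc N) \<le> x * (\<Sum>k\<le>N. w k * gf_upto x N ^ k)"
    by (rule gf_upto_Suc_le[OF assms(1)])
  also have "\<dots> \<le> x * (\<Sum>k\<le>N. w k * t ^ k)"
    using Suc assms(1) by (intro mult_left_mono sum_mono power_mono nonneg gf_upto_nonneg)
  also have "\<dots> \<le> t" by (rule assms(3))
  finally show ?case .
qed

lemma mono_gf_upto: "x \<ge> 0 \<Longrightarrow> mono (gf_upto x)"
  unfolding mono_def gf_upto_def
  by (intro allI impI sum_mono2 finite_tsize_le) (auto intro!: mult_nonneg_nonneg tweight_nonneg)

lemma tweight_Node_replicate: "tweight w (Node (replicate k (Node []))) = w k * w 0 ^ k"
  by (simp add: map_replicate_const prod_list_replicate)

text \<open>The witness is a root with \<open>k\<close> leaves as children; thus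
  \<open>w k > 0\<close> makes \<open>Z w (Suc k)\<close> positive.\<close>

lemma Z_Suc_ge: "w k * w 0 ^ k \<le> Z w (Suc k)"
proof -
  have "tsize (Node (replicate k (Node []))) = Suc k"
    by (simp add: map_replicate_const sum_list_replicate)
  then have "tweight w (Node (replicate k (Node []))) \<le> Z w (Suc k)"
    unfolding Z_def by (intro member_le_sum finite_tsize_eq tweight_nonneg) auto
  then show ?thesis by (simp only: tweight_Node_replicate)
qed

lemma gf_bounded_imp_subsolution:
  assumes "x > 0" "\<And>N. gf_upto x N \<le> B"
  shows "\<exists>t>0. \<forall>K. x * (\<Sum>k\<le>K. w k * t ^ k) \<le> t"
proof -
  have "Bseq (gf_upto x)"
    using assms gf_upto_nonneg[of x] by (intro BseqI'[of _ B]) simp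
  then have "convergent (gf_upto x)"
    using mono_gf_upto[of x] assms by (intro Bseq_mono_convergent) (auto simp: mono_def)
  then obtain t where t: "gf_upto x \<longlonglongrightarrow> t" by (auto simp: convergent_def)
  have le: "gf_upto x N \<le> t" for N
    using mono_gf_upto[of x] assms by (intro incseq_le[OF _ t]) auto
  \<comment> \<open>The one-node tree alone makes the limit positive.\<close>
  have "0 < x * w 0" using w0 assms by simp
  also have "\<dots> \<le> gf_upto x 1"
    using gf_upto_ge[of x 0 0] assms by simp
  also have "\<dots> \<le> t" by (rule le)
  finally have "t > 0" .
  \<comment> \<open>For fixed \<open>K\<close> let \<open>N\<close> grow: \<open>gf_upto_ge\<close>
    bounds the expression by \<open>gf_upto\<close> at index \<open>Suc (K * N)\<close>, hence by
    \<open>t\<close>.\<close>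
  moreover have "x * (\<Sum>k\<le>K. w k * t ^ k) \<le> t" for K
  proof (rule LIMSEQ_le_const2)
    show "(\<lambda>N. x * (\<Sum>k\<le>K. w k * gf_upto x N ^ k)) \<longlonglongrightarrow> x * (\<Sum>k\<le>K. w k * t ^ k)"
      by (intro tendsto_intros t)
    show "\<exists>N. \<forall>n\<ge>N. x * (\<Sum>k\<le>K. w k * gf_upto x n ^ k) \<le> t"
      using order_trans[OF gf_upto_ge le] assms(1) by auto
  qed
  ultimately show ?thesis by blast
qed

end

section \<open>Supermultiplicative growth\<close>

text \<open>The numerical semigroup theorem, with \<open>d\<close> the gcd of \<open>S\<close>. The
  assumption \<open>greatest\<close> also rules out \<open>S = {0}\<close>, of which every number is
  a common divisor.\<close>

lemma additive_semigroup_contains_multiples: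
  fixes S :: "nat set"
  assumes zero: "0 \<in> S" and add: "\<And>a b. a \<in> S \<Longrightarrow> b \<in> S \<Longrightarrow> a + b \<in> S"
    and dvd: "\<And>s. s \<in> S \<Longrightarrow> d dvd s"
    and greatest: "\<And>g. (\<And>s. s \<in> S \<Longrightarrow> g dvd s) \<Longrightarrow> g \<le> d"
  shows "\<exists>n0. \<forall>n\<ge>n0. d dvd n \<longrightarrow> n \<in> S"
proof -
  have mult: "u * a \<in> S" if "a \<in> S" for u a
    using that by (induction u) (auto simp: zero add)
  \<comment> \<open>The least positive difference of two elements of \<open>S\<close> divides all of \<open>S\<close>, hence is \<open>d\<close>.\<close>
  define P where "P g \<longleftrightarrow> g > 0 \<and> (\<exists>b\<in>S. b + g \<in> S)" for g
  have "\<exists>g. P g"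
  proof (rule ccontr)
    assume "\<nexists>g. P g"
    then have "s = 0" if "s \<in> S" for s
      using that zero unfolding P_def by (metis add_0 neq0_conv)
    then show False using greatest[of "Suc d"] by fastforce
  qed
  define g where "g = (LEAST g. P g)"
  have "P g" unfolding g_def using \<open>\<exists>g. P g\<close> by (rule LeastI_ex)
  then obtain b where b: "b \<in> S" "b + g \<in> S" and "g > 0" by (auto simp: P_def)
  have "g dvd s" if s: "s \<in> S" for s
  proof (rule ccontr)
    assume "\<not> g dvd s"
    then have pos: "s mod g > 0" by (simp add: mod_greater_zero_iff_not_dvd)
    \<comment> \<open>The residue \<open>s mod g\<close> is the difference of
      \<open>s + s div g * b\<close> and \<open>s div g * (b + g)\<close>, both in \<open>S\<close>,
      and would undercut the least difference \<open>g\<close>.\<close>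
    have "s + s div g * b = s div g * (b + g) + s mod g"
      by (simp add: algebra_simps)
    moreover have "s + s div g * b \<in> S" using add[OF s mult[OF b(1)]] .
    ultimately have "P (s mod g)"
      unfolding P_def using pos mult[OF b(2)] by metis
    then have "g \<le> s mod g" unfolding g_def by (rule Least_le)
    then show False using \<open>g > 0\<close> mod_less_divisor[of g s] by linarith
  qed
  then have "g \<le> d" by (rule greatest)
  moreover have "d dvd g" using dvd[OF b(1)] dvd[OF b(2)] dvd_add_right_iff by blast
  ultimately have gd: "g = d" using \<open>g > 0\<close> by (simp add: dvd_imp_le le_antisym)
  obtain q where q: "b = d * q" using dvd[OF b(1)] by (auto elim: dvdE)
  \<comment> \<open>Here \<open>b = d * q\<close> and \<open>b + g = d * (q + 1)\<close>. For
    \<open>q > 0\<close>, writing \<open>M = e * q + v * (q + 1)\<close> with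
    \<open>v = M mod q\<close> requires \<open>M mod q <= M div q\<close>, which
    \<open>M >= q * q\<close> ensures.\<close>
  have "n \<in> S" if n: "n \<ge> d * (q * q)" "d dvd n" for n
  proof -
    obtain M where M: "n = d * M" using n(2) by (auto elim: dvdE)
    show ?thesis
    proof (cases "q = 0")
      case True
      then have "d \<in> S" using b gd q by simp
      then show ?thesis using mult[of d M] M by (simp add: mult.commute)
    next
      case False
      have "M \<ge> q * q" using n(1) M \<open>g > 0\<close> gd by simp
      then have "M div q \<ge> q" using False by (simp add: less_eq_div_iff_mult_less_eq)
      then have "M mod q \<le> M div q" using False mod_less_divisor[of q M] by linarith
      then obtain e where e: "M div q = M mod q + e" using le_Suc_ex by blast
      define v where "v = M mod q"
      have "M = q * (v + e) + v" unfolding v_def e[symmetric] by simp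
      then have "n = e * b + v * (b + g)"
        unfolding M q gd by (simp add: algebra_simps)
      then show ?thesis using add mult b by simp
    qed
  qed
  then show ?thesis by blast
qed

text \<open>Induction in steps of \<open>p\<close>: each step gains a factor \<open>a p\<close>, at
  least \<open>c ^ p\<close>, and one window of length \<open>p\<close> starts it.\<close>

lemma supermultiplicative_ge_geometric:
  fixes a :: "nat \<Rightarrow> real"
  assumes super: "\<And>m n. a m * a n \<le> a (m + n)"
    and pos: "\<And>n. n \<ge> n0 \<Longrightarrow> d dvd n \<Longrightarrow> a n > 0"
    and p: "d dvd p" "p > 0" and c: "c > 0" "c ^ p \<le> a p"
  shows "\<exists>K>0. \<forall>n\<ge>n0. d dvd n \<longrightarrow> K * c ^ n \<le> a n"
proof -
  define R where "R = {r \<in> {n0..<n0 + p}. d dvd r}"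
  \<comment> \<open>The worst ratio over the window; the inserted 1 keeps the set nonempty by
    construction.\<close>
  define K where "K = Min (insert 1 ((\<lambda>r. a r / c ^ r) ` R))"
  have fin: "finite R" by (simp add: R_def)
  have "K > 0"
    unfolding K_def using fin pos c by (auto simp: R_def)
  moreover have "K * c ^ n \<le> a n" if "n \<ge> n0" "d dvd n" for n
    using that
  proof (induction n rule: less_induct)
    case (less n)
    show ?case
    proof (cases "n < n0 + p")
      case True
      then have "K \<le> a n / c ^ n"
        unfolding K_def using fin less by (intro Min_le) (auto simp: R_def)
      then show ?thesis using c by (simp add: field_simps)
    next
      case False
      have "K * c ^ (n - p) \<le> a (n - p)"
        using False less p by (intro less.IH) (auto intro: dvd_diff_nat)
      then have "K * c ^ (n - p) * c ^ p \<le> a (n - p) * a p"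
        using c pos[of "n - p"] False less p by (intro mult_mono) (auto intro: less_imp_le dvd_diff_nat)
      also have "\<dots> \<le> a n" using super[of "n - p" p] False by simp
      also have "K * c ^ (n - p) * c ^ p = K * c ^ n"
        using False by (simp add: mult.assoc flip: power_add)
      finally show ?thesis .
    qed
  qed
  ultimately show ?thesis by blast
qed

section \<open>Divisibility by the span, and geometric bounds for \<open>Z\<close> from both
  sides\<close>

context weight_sequence
begin

text \<open>\<open>GREATEST\<close> is meaningful only if the candidates are bounded; a positive
  weight at some \<open>k0 >= 2\<close> bounds them.\<close>

lemma
  shows span_dvd: "w k > 0 \<Longrightarrow> span w dvd k"
    and span_greatest: "(\<And>k. w k > 0 \<Longrightarrow> g dvd k) \<Longrightarrow> g \<le> span w"
proof -
  let ?P = "\<lambda>d. d \<ge> 1 \<and> (\<forall>k. w k > 0 \<longrightarrow> d dvd k)"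
  obtain k0 where k0: "k0 \<ge> 2" "w k0 > 0" using wk by blast
  have bound: "d \<le> k0" if "?P d" for d
    using k0 that by (auto intro: dvd_imp_le)
  have P: "?P (span w)" unfolding span_def by (rule GreatestI_nat[of ?P 1, OF _ bound]) auto
  show "w k > 0 \<Longrightarrow> span w dvd k" using P by simp
  assume g: "\<And>k. w k > 0 \<Longrightarrow> g dvd k"
  then have "g \<ge> 1" using k0 by (metis dvd_0_left_iff less_one not_le not_numeral_le_zero)
  then show "g \<le> span w" unfolding span_def using g by (intro Greatest_le_nat[OF _ bound]) auto
qed

text \<open>Positive weight makes the root degree a multiple of \<open>span w\<close>, and by
  induction each child has size congruent to 1.\<close>

lemma tsize_cong_1:
  assumes "tweight w T > 0"
  shows "\<exists>q. tsize T = Suc (span w * q)"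
  using assms
proof (induction T)
  case (Node Ts)
  have "w (length Ts) \<noteq> 0" "\<And>T. T \<in> set Ts \<Longrightarrow> tweight w T \<noteq> 0"
    using Node.prems by (auto simp: zero_less_mult_iff prod_list_zero_iff image_iff dest!: less_imp_neq)
  then have "w (length Ts) > 0" and ch: "\<And>T. T \<in> set Ts \<Longrightarrow> tweight w T > 0"
    using nonneg tweight_nonneg by (auto simp: less_le)
  then obtain r where r: "length Ts = span w * r" using span_dvd dvd_def by blast
  have "\<forall>T\<in>set Ts. \<exists>q. tsize T = Suc (span w * q)" using Node.IH ch by blast
  then have "\<exists>q. sum_list (map tsize Ts) = length Ts + span w * q"
  proof (induction Ts)
    case (Cons T Ts)
    then obtain q q' where "sum_list (map tsize Ts) = length Ts + span w * q"
      "tsize T = Suc (span w * q')" by auto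
    then show ?case by (intro exI[of _ "q + q'"]) (simp add: algebra_simps)
  qed simp
  then obtain q where "sum_list (map tsize Ts) = length Ts + span w * q" ..
  then have "tsize (Node Ts) = Suc (span w * (r + q))"
    by (simp add: r algebra_simps)
  then show ?case by blast
qed

lemma Z_Suc_pos_imp_dvd:
  assumes "Z w (Suc n) > 0"
  shows "span w dvd n"
proof -
  obtain T where "tsize T = Suc n" "tweight w T > 0"
  proof (rule ccontr)
    assume "\<not> thesis"
    then have "\<And>T. tsize T = Suc n \<Longrightarrow> tweight w T = 0"
      using that tweight_nonneg by (metis less_le)
    then have "Z w (Suc n) = 0" unfolding Z_def by (intro sum.neutral) auto
    then show False using assms by simp
  qed
  then show ?thesis using tsize_cong_1 by fastforce
qed

text \<open>Shifting the index by one turns grafting into addition, so the positive positions form a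
  semigroup. It contains every \<open>k\<close> with \<open>w k > 0\<close>, so its common divisors
  are at most the span.\<close>

lemma Z_Suc_eventually_pos: "\<exists>n0. \<forall>n\<ge>n0. span w dvd n \<longrightarrow> Z w (Suc n) > 0"
proof -
  define S where "S = {n. Z w (Suc n) > 0}"
  have S: "k \<in> S" if "w k > 0" for k
    using less_le_trans[OF _ Z_Suc_ge[of k]] that w0 by (simp add: S_def)
  have "\<exists>n0. \<forall>n\<ge>n0. span w dvd n \<longrightarrow> n \<in> S"
  proof (rule additive_semigroup_contains_multiples)
    show "0 \<in> S" using S w0 by blast
    show "a + b \<in> S" if "a \<in> S" "b \<in> S" for a b
    proof -
      have "0 < Z w (Suc a) * Z w (Suc b)" using that by (simp add: S_def)
      then have "0 < w 0 * Z w (Suc (a + b))" using Z_supermult less_le_trans by blast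
      then show ?thesis using w0 by (simp add: S_def zero_less_mult_iff)
    qed
    show "span w dvd s" if "s \<in> S" for s using that Z_Suc_pos_imp_dvd by (simp add: S_def)
    show "g \<le> span w" if "\<And>s. s \<in> S \<Longrightarrow> g dvd s" for g
      using that S by (intro span_greatest) blast
  qed
  then show ?thesis by (simp add: S_def)
qed

text \<open>Apply \<open>gf_upto_le\<close> at \<open>x = 1 / c\<close> and keep one term of the
  truncated series.\<close>

lemma Z_le_geometric:
  assumes "t > 0" "c > 0" "\<And>K. (\<Sum>k\<le>K. w k * t ^ k) \<le> c * t"
  shows "Z w n \<le> t * c ^ n"
proof -
  have "gf_upto (1 / c) n \<le> t"
    using assms by (intro gf_upto_le) (auto simp: field_simps)
  moreover have "Z w n * (1 / c) ^ n \<le> gf_upto (1 / c) n"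
    unfolding gf_upto_eq_Z using assms(2) Z_nonneg
    by (intro member_le_sum[where f = "\<lambda>n. Z w n * (1 / c) ^ n"]) auto
  ultimately have "Z w n * (1 / c) ^ n \<le> t" by simp
  then show ?thesis using assms(2) by (simp add: field_simps power_divide)
qed

text \<open>If \<open>a p < c ^ p\<close> for all \<open>p > 0\<close>, the gap
  \<open>c < c'\<close> would make the tree series converge at \<open>1 / c'\<close>, yielding a
  \<open>t\<close> that contradicts the last assumption. A single good \<open>p\<close> then spreads
  by supermultiplicativity.\<close>

lemma Z_ge_geometric:
  assumes "0 < c" "c < c'" "\<And>t. t > 0 \<Longrightarrow> \<exists>K. c' * t < (\<Sum>k\<le>K. w k * t ^ k)"
  shows "\<exists>K>0. \<forall>\<^sub>F n in sequentially. n mod span w = 1 mod span w \<longrightarrow> K * c ^ n \<le> Z w n"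
proof -
  define a where "a n = Z w (Suc n) / w 0" for n
  have "\<exists>p>0. c ^ p \<le> a p"
  proof (rule ccontr)
    assume "\<not> ?thesis"
    then have less: "a p < c ^ p" if "p > 0" for p using that not_le by blast
    have le: "Z w n * (1 / c') ^ n \<le> w 0 / c * (c / c') ^ n" if "n \<ge> 2" for n
    proof -
      obtain p where p: "n = Suc p" "p > 0" using \<open>n \<ge> 2\<close> by (cases n) auto
      then have "Z w n \<le> w 0 / c * c ^ n" using less[of p] w0 assms(1) by (simp add: a_def field_simps)
      then have "Z w n / c' ^ n \<le> w 0 / c * c ^ n / c' ^ n"
        using assms(1,2) by (intro divide_right_mono) auto
      then show ?thesis by (simp add: power_divide)
    qed
    have sm: "summable (\<lambda>n. Z w n * (1 / c') ^ n)"
    proof (rule summable_comparison_test)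
      show "\<exists>N. \<forall>n\<ge>N. norm (Z w n * (1 / c') ^ n) \<le> w 0 / c * (c / c') ^ n"
        using le Z_nonneg assms(1,2) by (intro exI[of _ 2]) (auto simp: abs_mult)
      show "summable (\<lambda>n. w 0 / c * (c / c') ^ n)"
        using assms(1,2) by (intro summable_mult summable_geometric) auto
    qed
    have "gf_upto (1 / c') N \<le> (\<Sum>n. Z w n * (1 / c') ^ n)" for N
      unfolding gf_upto_eq_Z using Z_nonneg assms(1,2) by (intro sum_le_suminf sm) auto
    note bounded = this
    obtain t where t: "t > 0" "\<And>K. (1 / c') * (\<Sum>k\<le>K. w k * t ^ k) \<le> t"
      using gf_bounded_imp_subsolution[of "1 / c'", OF _ bounded] assms(1,2) by auto
    obtain K where "c' * t < (\<Sum>k\<le>K. w k * t ^ k)" using assms(3) t(1) by blast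
    then show False using t(2)[of K] assms(1,2) by (simp add: field_simps)
  qed
  then obtain p where p: "p > 0" "c ^ p \<le> a p" by blast
  have "a p > 0" using less_le_trans[OF _ p(2)] assms(1) by simp
  then have dp: "span w dvd p" using w0 by (intro Z_Suc_pos_imp_dvd) (simp add: a_def zero_less_divide_iff)
  obtain n0 where n0: "\<And>n. n \<ge> n0 \<Longrightarrow> span w dvd n \<Longrightarrow> Z w (Suc n) > 0"
    using Z_Suc_eventually_pos by blast
  have "\<exists>K>0. \<forall>n\<ge>n0. span w dvd n \<longrightarrow> K * c ^ n \<le> a n"
  proof (rule supermultiplicative_ge_geometric[where a = a and d = "span w" and p = p])
    show "a m * a n \<le> a (m + n)" for m n
      using Z_supermult[of m n] w0 by (simp add: a_def field_simps)
    show "a n > 0" if "n \<ge> n0" "span w dvd n" for n using n0 that w0 by (simp add: a_def)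
  qed (use dp p assms(1) in auto)
  then obtain K where K: "K > 0" "\<And>n. n \<ge> n0 \<Longrightarrow> span w dvd n \<Longrightarrow> K * c ^ n \<le> a n" by blast
  \<comment> \<open>The factor \<open>w 0 / c\<close> undoes the normalisation of \<open>a\<close>
    and its index shift.\<close>
  have "K * w 0 / c * c ^ n \<le> Z w n" if n: "n \<ge> Suc n0" "n mod span w = 1 mod span w" for n
  proof -
    obtain m where m: "n = Suc m" using n by (cases n) auto
    have "span w dvd m" using n m mod_eq_dvd_iff_nat[of 1 n "span w"] by simp
    then have "K * c ^ m \<le> a m" using K n m by simp
    then show ?thesis using w0 assms(1) m by (simp add: a_def field_simps)
  qed
  then have "\<forall>\<^sub>F n in sequentially. n mod span w = 1 mod span w \<longrightarrow> K * w 0 / c * c ^ n \<le> Z w n"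
    unfolding eventually_sequentially by blast
  then show ?thesis using K(1) w0 assms(1) by (intro exI[of _ "K * w 0 / c"]) simp
qed

end

section \<open>The generating function of the weights\<close>

text \<open>Stated for a general filter to serve both limits in \<open>nu\<close>: at infinity and
  from the left at the radius of convergence.\<close>

lemma tendsto_SUP_of_mono_along:
  fixes f :: "'a \<Rightarrow> 'b :: {complete_linorder, linorder_topology}"
  assumes "eventually (\<lambda>t. t \<in> S) F"
    and "\<And>s. s \<in> S \<Longrightarrow> eventually (\<lambda>t. f s \<le> f t) F"
  shows "(f \<longlongrightarrow> (SUP s\<in>S. f s)) F"
proof (rule order_tendstoI)
  fix a assume "a < (SUP s\<in>S. f s)"
  then obtain s where "s \<in> S" "a < f s" by (auto simp: less_SUP_iff)
  then show "eventually (\<lambda>t. a < f t) F"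
    using assms(2)[of s] by (auto elim: eventually_mono)
next
  fix a assume a: "(SUP s\<in>S. f s) < a"
  show "eventually (\<lambda>t. f t < a) F"
    using assms(1) by eventually_elim (use a SUP_upper[of _ S f] in \<open>auto intro: le_less_trans\<close>)
qed

context weight_sequence
begin

abbreviation summable_at :: "real \<Rightarrow> bool" where
  "summable_at t \<equiv> summable (\<lambda>k. w k * t ^ k)"

abbreviation moment_summable_at :: "real \<Rightarrow> bool" where
  "moment_summable_at t \<equiv> summable (\<lambda>k. real k * w k * t ^ k)"

definition phi :: "real \<Rightarrow> real" where
  "phi t = (\<Sum>k. w k * t ^ k)"

text \<open>This is \<open>t * Phi'(t)\<close> as a series, which may converge also at the radius of
  convergence.\<close>

definition moment :: "real \<Rightarrow> real" where
  "moment t = (\<Sum>k. real k * w k * t ^ k)"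

text \<open>
  The \<open>k = 0\<close> term vanishes by truncated subtraction, so \<open>\<Psi>(t) < 1\<close>, \<open>= 1\<close>, \<open>> 1\<close> means
  \<open>excess t < w\<^sub>0\<close>, \<open>= w\<^sub>0\<close>, \<open>> w\<^sub>0\<close> respectively, and unlike \<open>\<Psi>\<close> the function \<open>excess\<close> has
  nonnegative coefficients.
\<close>
definition excess :: "real \<Rightarrow> real" where
  "excess t = (\<Sum>k. real (k - 1) * w k * t ^ k)"

lemma term_nonneg: "t \<ge> 0 \<Longrightarrow> w k * t ^ k \<ge> 0"
  by (simp add: nonneg)

lemma moment_term_nonneg: "t \<ge> 0 \<Longrightarrow> real j * w k * t ^ k \<ge> 0"
  by (simp add: nonneg)

lemma Phi_eq: "t \<ge> 0 \<Longrightarrow> summable_at t \<Longrightarrow> Phi w t = ennreal (phi t)"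
  unfolding Phi_def phi_def by (intro suminf_ennreal2 term_nonneg)

lemma Phi_finite_iff:
  assumes "t \<ge> 0"
  shows "Phi w t \<noteq> top \<longleftrightarrow> summable_at t"
proof
  assume "Phi w t \<noteq> top"
  then show "summable_at t"
    unfolding Phi_def by (rule summable_suminf_not_top[OF term_nonneg[OF assms]])
next
  assume "summable_at t"
  then show "Phi w t \<noteq> top" by (simp add: Phi_eq[OF assms])
qed

lemma phi_pos:
  assumes "t \<ge> 0" "summable_at t"
  shows "phi t > 0"
  unfolding phi_def using assms w0
  by (intro suminf_pos2[of _ 0] term_nonneg) auto

lemma sum_le_phi: "t \<ge> 0 \<Longrightarrow> summable_at t \<Longrightarrow> (\<Sum>k\<le>K. w k * t ^ k) \<le> phi t"
  unfolding phi_def by (intro sum_le_suminf) (auto simp: nonneg)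

lemma summable_at_of_bounded:
  assumes "t \<ge> 0" "\<And>K. (\<Sum>k\<le>K. w k * t ^ k) \<le> B"
  shows "summable_at t" "phi t \<le> B"
proof -
  have le: "(\<Sum>k<K. w k * t ^ k) \<le> B" for K
    using assms(2)[of K] sum_mono2[of "{..K}" "{..<K}" "\<lambda>k. w k * t ^ k"] term_nonneg[OF assms(1)]
    by fastforce
  show S: "summable_at t"
    using le by (intro summableI_nonneg_bounded term_nonneg assms(1))
  show "phi t \<le> B" unfolding phi_def using le by (intro suminf_le_const S)
qed

lemma summable_at_less_rho: "t \<ge> 0 \<Longrightarrow> ereal t < rho w \<Longrightarrow> summable_at t"
  unfolding rho_def by (intro summable_in_conv_radius) simp

lemma le_rho: "t \<ge> 0 \<Longrightarrow> summable_at t \<Longrightarrow> ereal t \<le> rho w"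
  unfolding rho_def using conv_radius_geI[of w t] by simp

text \<open>The termwise derivative converges strictly inside a disc of radius
  \<open>K < rho w\<close>; multiply it by \<open>t\<close>.\<close>

lemma moment_summable_at_less_rho:
  assumes "t \<ge> 0" "ereal t < rho w"
  shows "moment_summable_at t"
proof -
  obtain K where K: "ereal t < ereal K" "ereal K < rho w" using ereal_dense2[OF assms(2)] by auto
  have "summable (\<lambda>n. diffs w n * t ^ n)"
  proof (rule termdiff_converges)
    show "norm t < K" using assms K by simp
    show "summable_at x" if "norm x < K" for x
      using that K
      by (intro summable_in_conv_radius) (auto simp: rho_def intro: less_trans[of _ "ereal K"])
  qed
  then have "summable (\<lambda>n. t * (diffs w n * t ^ n))" by (rule summable_mult)
  then have "summable (\<lambda>n. real (Suc n) * w (Suc n) * t ^ Suc n)"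
    by (simp add: diffs_def algebra_simps)
  then show ?thesis by (subst (asm) summable_Suc_iff)
qed

lemma summable_at_if_moment:
  assumes "t \<ge> 0" "moment_summable_at t"
  shows "summable_at t"
  using assms(2)
proof (rule summable_comparison_test'[of _ 1])
  fix k :: nat assume "k \<ge> 1"
  then have "1 * (w k * t ^ k) \<le> real k * (w k * t ^ k)"
    using term_nonneg[OF assms(1)] by (intro mult_right_mono) auto
  then show "norm (w k * t ^ k) \<le> real k * w k * t ^ k"
    using term_nonneg[OF assms(1), of k] by (simp add: mult.assoc)
qed

lemma excess_sums:
  assumes "t \<ge> 0" "moment_summable_at t"
  shows "(\<lambda>k. real (k - 1) * w k * t ^ k) sums (moment t - phi t + w 0)"
proof -
  \<comment> \<open>The \<open>if\<close> term cancels the \<open>- w 0\<close> at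
    \<open>k = 0\<close>, matching truncated subtraction.\<close>
  have "(\<lambda>k. real k * w k * t ^ k - w k * t ^ k + (if k = 0 then w 0 else 0)) sums (moment t - phi t + w 0)"
    unfolding moment_def phi_def
    by (intro sums_add sums_diff summable_sums assms summable_at_if_moment sums_single)
  also have "(\<lambda>k. real k * w k * t ^ k - w k * t ^ k + (if k = 0 then w 0 else 0))
      = (\<lambda>k. real (k - 1) * w k * t ^ k)"
  proof
    fix k show "real k * w k * t ^ k - w k * t ^ k + (if k = 0 then w 0 else 0) = real (k - 1) * w k * t ^ k"
      by (cases k) (simp_all add: algebra_simps)
  qed
  finally show ?thesis .
qed

lemma excess_eq:
  assumes "t \<ge> 0" "moment_summable_at t"
  shows "excess t = moment t - phi t + w 0"
  unfolding excess_def using sums_unique[OF excess_sums[OF assms]] by simp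

lemma moment_summable_at_if_excess:
  assumes "t \<ge> 0" "summable (\<lambda>k. real (k - 1) * w k * t ^ k)"
  shows "moment_summable_at t"
proof (rule summable_comparison_test'[of _ 2])
  show "summable (\<lambda>k. 2 * (real (k - 1) * w k * t ^ k))" using assms(2) by (rule summable_mult)
  fix k :: nat assume "k \<ge> 2"
  then have "real k * (w k * t ^ k) \<le> (2 * real (k - 1)) * (w k * t ^ k)"
    using term_nonneg[OF assms(1)] by (intro mult_right_mono) auto
  then show "norm (real k * w k * t ^ k) \<le> 2 * (real (k - 1) * w k * t ^ k)"
    using moment_term_nonneg[OF assms(1), of k k] by (simp add: mult.assoc)
qed

lemma moment_summable_at_mono:
  assumes "0 \<le> s" "s \<le> t" "moment_summable_at t"
  shows "moment_summable_at s"
  using assms(3)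
proof (rule summable_comparison_test'[of _ 0])
  show "norm (real k * w k * s ^ k) \<le> real k * w k * t ^ k" for k
    using mult_left_mono[OF power_mono[OF assms(2,1)], of "real k * w k" k]
      moment_term_nonneg[OF assms(1), of k k] nonneg by simp
qed

text \<open>Strictness comes from an index \<open>k0 >= 2\<close> of positive weight, where the
  factor \<open>k0 - 1\<close> does not vanish.\<close>

lemma excess_strict_mono:
  assumes "0 \<le> s" "s < t" "moment_summable_at t"
  shows "excess s < excess t"
proof -
  obtain k0 where k0: "k0 \<ge> 2" "w k0 > 0" using wk by blast
  have s: "summable (\<lambda>k. real (k - 1) * w k * s ^ k)" and t: "summable (\<lambda>k. real (k - 1) * w k * t ^ k)"
    using excess_sums[of s] excess_sums[of t] moment_summable_at_mono[of s t] assms by (auto simp: sums_iff)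
  have "0 < (\<Sum>k. real (k - 1) * w k * t ^ k - real (k - 1) * w k * s ^ k)"
  proof (rule suminf_pos2[of _ k0])
    show "summable (\<lambda>k. real (k - 1) * w k * t ^ k - real (k - 1) * w k * s ^ k)"
      using t s by (rule summable_diff)
    show "0 \<le> real (k - 1) * w k * t ^ k - real (k - 1) * w k * s ^ k" for k
      using assms nonneg by (auto intro!: mult_left_mono power_mono)
    show "0 < real (k0 - 1) * w k0 * t ^ k0 - real (k0 - 1) * w k0 * s ^ k0"
      using assms k0 by (auto intro!: mult_strict_left_mono power_strict_mono)
  qed
  also have "\<dots> = excess t - excess s"
    unfolding excess_def using t s by (rule suminf_diff[symmetric])
  finally show ?thesis by simp
qed

section \<open>The ratio \<open>Psi\<close>: comparison with \<open>excess\<close>, monotonicity,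
  endpoint value\<close>

lemma Psi_eq:
  assumes "t \<ge> 0" "moment_summable_at t"
  shows "Psi w t = ennreal (moment t / phi t)"
proof -
  have "(\<Sum>k. ennreal (real k * w k * t ^ k)) = ennreal (moment t)"
    unfolding moment_def by (intro suminf_ennreal2 moment_term_nonneg assms)
  moreover have "moment t \<ge> 0"
    unfolding moment_def by (intro suminf_nonneg moment_term_nonneg assms)
  ultimately show ?thesis
    unfolding Psi_def using Phi_eq[of t] phi_pos[of t] assms summable_at_if_moment[of t]
    by (simp add: divide_ennreal)
qed

lemma Psi_eq_top:
  assumes "t \<ge> 0" "summable_at t" "\<not> moment_summable_at t"
  shows "Psi w t = top"
proof -
  have "(\<Sum>k. ennreal (real k * w k * t ^ k)) = top"
    using assms summable_suminf_not_top[of "\<lambda>k. real k * w k * t ^ k"] moment_term_nonneg by blast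
  then show ?thesis unfolding Psi_def using Phi_eq assms by (simp add: ennreal_top_divide)
qed

lemma Psi_less_1_iff:
  assumes "t \<ge> 0" "moment_summable_at t"
  shows "Psi w t < 1 \<longleftrightarrow> excess t < w 0"
  unfolding Psi_eq[OF assms] excess_eq[OF assms]
  using phi_pos[OF assms(1) summable_at_if_moment[OF assms]]
  by (simp add: ennreal_less_one_iff)

lemma Psi_eq_1_iff:
  assumes "t \<ge> 0" "moment_summable_at t"
  shows "Psi w t = 1 \<longleftrightarrow> excess t = w 0"
  unfolding Psi_eq[OF assms] excess_eq[OF assms]
  using phi_pos[OF assms(1) summable_at_if_moment[OF assms]]
  by (auto simp: ennreal_eq_1)

lemma Psi_mono:
  assumes "0 \<le> s" "s \<le> t" "ereal t < rho w"
  shows "Psi w s \<le> Psi w t"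
proof (cases "s = 0")
  case True
  have "(\<Sum>k. ennreal (real k * w k * 0 ^ k)) = 0"
    by (subst suminf_finite[of "{}"]) (auto simp: power_0_left)
  then show ?thesis using True by (simp add: Psi_def)
next
  case False
  then have "s > 0" using assms by simp
  have mt: "moment_summable_at t" using assms by (intro moment_summable_at_less_rho) auto
  have ms: "moment_summable_at s" using moment_summable_at_mono[OF assms(1,2) mt] .
  have st: "summable_at t" and ss: "summable_at s"
    using summable_at_if_moment assms mt ms by auto
  \<comment> \<open>\<open>\<Sum> (k - m) w\<^sub>k s\<^sup>k = 0\<close>, and \<open>(k - m) r\<^sup>k \<ge> (k - m) r\<^sup>m\<close> for \<open>r \<ge> 1\<close> whatever the sign of \<open>k - m\<close>.\<close>
  define m where "m = moment s / phi s"
  define r where "r = t / s"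
  have r: "r \<ge> 1" "t = s * r" using \<open>s > 0\<close> assms(2) by (auto simp: r_def)
  have "0 = (moment s - m * phi s) * r powr m"
    using phi_pos[OF assms(1) ss] by (simp add: m_def)
  also have "\<dots> = (\<Sum>k. (real k * w k * s ^ k - m * (w k * s ^ k)) * r powr m)"
    unfolding moment_def phi_def
    by (intro sums_unique sums_mult2 sums_diff sums_mult summable_sums ms ss)
  also have "\<dots> \<le> (\<Sum>k. real k * w k * t ^ k - m * (w k * t ^ k))"
  proof (rule suminf_le)
    show "summable (\<lambda>k. (real k * w k * s ^ k - m * (w k * s ^ k)) * r powr m)"
      by (intro summable_mult2 summable_diff summable_mult ms ss)
    show "summable (\<lambda>k. real k * w k * t ^ k - m * (w k * t ^ k))"
      by (intro summable_diff summable_mult mt st)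
    fix k
    have "0 \<le> (real k - m) * (r powr real k - r powr m)"
      using r by (cases "real k \<le> m") (auto simp: powr_mono intro!: mult_nonneg_nonneg mult_nonpos_nonpos)
    then have "0 \<le> (w k * s ^ k) * ((real k - m) * (r ^ k - r powr m))"
      using r mult_nonneg_nonneg[OF term_nonneg[OF assms(1)]] by (simp add: powr_realpow)
    then show "(real k * w k * s ^ k - m * (w k * s ^ k)) * r powr m \<le> real k * w k * t ^ k - m * (w k * t ^ k)"
      by (simp add: r(2) power_mult_distrib algebra_simps)
  qed
  also have "\<dots> = moment t - m * phi t"
    unfolding moment_def phi_def
    by (intro sums_unique[symmetric] sums_diff sums_mult summable_sums mt st)
  finally have "m \<le> moment t / phi t"
    using phi_pos[OF _ st] assms by (simp add: field_simps)
  then show ?thesis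
    using assms mt ms by (simp add: Psi_eq m_def ennreal_leI)
qed

text \<open>Where \<open>nu w\<close> is defined by a limit, monotonicity of \<open>Psi\<close>
  makes that limit a supremum.\<close>

lemma Psi_le_nu:
  assumes "0 \<le> s" "ereal s < rho w"
    and "rho w = \<infinity> \<or> Phi w (real_of_ereal (rho w)) = \<infinity>"
  shows "Psi w s \<le> nu w"
proof (cases "rho w = \<infinity>")
  case True
  have "(Psi w \<longlongrightarrow> (SUP t\<in>{0..}. Psi w t)) at_top"
  proof (rule tendsto_SUP_of_mono_along)
    show "\<forall>\<^sub>F t::real in at_top. t \<in> {0..}" using eventually_ge_at_top[of "0::real"] by simp
    show "\<forall>\<^sub>F u in at_top. Psi w t \<le> Psi w u" if "t \<in> {0..}" for t
      using eventually_ge_at_top[of t] by eventually_elim (use that True in \<open>auto intro: Psi_mono\<close>)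
  qed
  then have "nu w = (SUP t\<in>{0..}. Psi w t)" using True by (simp add: nu_def tendsto_Lim)
  then show ?thesis using assms by (auto intro: SUP_upper)
next
  case False
  then obtain R where R: "rho w = ereal R" using assms(2) by (cases "rho w") auto
  have "(Psi w \<longlongrightarrow> (SUP t\<in>{0..<R}. Psi w t)) (at_left R)"
  proof (rule tendsto_SUP_of_mono_along)
    have sR: "s < R" using R assms by simp
    show "\<forall>\<^sub>F t in at_left R. t \<in> {0..<R}"
      using eventually_at_left_real[OF sR] by eventually_elim (use assms in auto)
    show "\<forall>\<^sub>F u in at_left R. Psi w t \<le> Psi w u" if "t \<in> {0..<R}" for t
      using eventually_at_left_real[of t R] that R
      by (auto elim!: eventually_mono intro!: Psi_mono)
  qed
  then have "nu w = (SUP t\<in>{0..<R}. Psi w t)"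
    using R assms(3) False by (simp add: nu_def tendsto_Lim)
  then show ?thesis using assms R by (auto intro: SUP_upper)
qed

text \<open>If the excess at the supremum \<open>T\<close> were below \<open>w 0\<close> with
  \<open>T\<close> inside the radius of convergence, continuity would allow a larger point; this
  leaves the two alternatives.\<close>

lemma ex_critical_point:
  "\<exists>T\<ge>0. moment_summable_at T \<and> (excess T = w 0 \<or> excess T < w 0 \<and> rho w = ereal T)"
proof -
  let ?e = "\<lambda>t k. real (k - 1) * w k * t ^ k"
  obtain k0 where k0: "k0 \<ge> 2" "w k0 > 0" using wk by blast
  \<comment> \<open>Conditions on partial sums are closed in \<open>t\<close>, and their common
    bound gives convergence at the supremum.\<close>
  define A where "A = {t. 0 \<le> t \<and> (\<forall>K. (\<Sum>k\<le>K. ?e t k) \<le> w 0)}"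
  have "closed A"
    unfolding A_def by (intro closed_Collect_conj closed_Collect_all closed_Collect_le continuous_intros)
  have "0 \<in> A"
  proof -
    have "(\<Sum>k\<le>K. ?e 0 k) = 0" for K by (intro sum.neutral) (auto simp: power_0_left)
    then show ?thesis unfolding A_def using w0 by simp
  qed
  have bdd: "bdd_above A"
  proof (rule bdd_aboveI)
    fix t assume t: "t \<in> A"
    show "t \<le> max 1 (w 0 / w k0)"
    proof (cases "t \<le> 1")
      case False
      \<comment> \<open>For \<open>t > 1\<close> the single term at \<open>k0\<close> is at least
        \<open>w k0 * t\<close>, yet at most \<open>w 0\<close>.\<close>
      have "w k0 * t \<le> w k0 * t ^ k0"
        using False k0 self_le_power[of t k0] by (intro mult_left_mono) auto
      also have "1 * (w k0 * t ^ k0) \<le> real (k0 - 1) * (w k0 * t ^ k0)"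
        using k0 False by (intro mult_right_mono) auto
      also have "\<dots> = ?e t k0" by simp
      also have "\<dots> \<le> (\<Sum>k\<le>k0. ?e t k)"
        using t nonneg by (intro member_le_sum) (auto simp: A_def)
      also have "\<dots> \<le> w 0" using t by (simp add: A_def)
      finally have "t \<le> w 0 / w k0" using k0 by (simp add: field_simps)
      then show ?thesis by simp
    qed simp
  qed
  define T where "T = Sup A"
  have "T \<in> A" unfolding T_def using \<open>closed A\<close> \<open>0 \<in> A\<close> bdd by (intro closed_contains_Sup) auto
  then have T: "T \<ge> 0" "\<And>K. (\<Sum>k\<le>K. ?e T k) \<le> w 0" by (auto simp: A_def)
  have le: "(\<Sum>k<K. ?e T k) \<le> w 0" for K
    using T(2)[of K] sum_mono2[of "{..K}" "{..<K}" "?e T"] moment_term_nonneg[OF T(1)]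
    by fastforce
  have sm: "summable (?e T)"
    using le by (intro summableI_nonneg_bounded moment_term_nonneg T(1))
  have ms: "moment_summable_at T" using moment_summable_at_if_excess[OF T(1) sm] .
  have exT: "excess T \<le> w 0" unfolding excess_def using le by (intro suminf_le_const sm)
  have "rho w = ereal T" if less: "excess T < w 0"
  proof (rule ccontr)
    assume "rho w \<noteq> ereal T"
    then have "ereal T < rho w"
      using le_rho[OF T(1) summable_at_if_moment[OF T(1) ms]] by simp
    then obtain K where K: "T < K" "ereal K < rho w" using ereal_dense2[of "ereal T" "rho w"] by auto
    have mK: "moment_summable_at K" using K T(1) by (intro moment_summable_at_less_rho) auto
    have sK: "summable (?e K)" using excess_sums[OF _ mK] K T(1) by (auto simp: sums_iff)
    have "isCont excess T"
      unfolding excess_def using isCont_powser[of "\<lambda>k. real (k - 1) * w k" K T] sK K T(1) by simp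
    then have "(excess \<longlongrightarrow> excess T) (at_right T)"
      by (simp add: isCont_def filterlim_at_split)
    then have "\<forall>\<^sub>F t in at_right T. excess t < w 0" using less by (rule order_tendstoD)
    moreover have "\<forall>\<^sub>F t in at_right T. t \<in> {T<..<K}" by (rule eventually_at_right_real[OF K(1)])
    ultimately have "\<forall>\<^sub>F t in at_right T. excess t < w 0 \<and> t \<in> {T<..<K}" by (rule eventually_conj)
    then obtain t where t: "excess t < w 0" "T < t" "t < K"
      using eventually_happens[of _ "at_right T"] by (auto simp: trivial_limit_at_right_real)
    have mt: "moment_summable_at t" using t T(1) by (intro moment_summable_at_mono[OF _ _ mK]) auto
    have st: "summable (?e t)" using excess_sums[OF _ mt] t T(1) by (auto simp: sums_iff)
    have "(\<Sum>k\<le>K. ?e t k) \<le> w 0" for K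
      using sum_le_suminf[OF st, of "{..K}"] moment_term_nonneg[of t] t T(1) unfolding excess_def by fastforce
    then have "t \<in> A" using t T(1) by (simp add: A_def)
    then have "t \<le> T" unfolding T_def using bdd by (rule cSup_upper)
    then show False using t by simp
  qed
  then show ?thesis using T(1) ms exT by (intro exI[of _ T]) auto
qed

text \<open>Termwise, \<open>r\<^bsup>k - 1\<^esup> \<ge> 1 + (k - 1) ln r\<close> with \<open>r = t / T\<close>.\<close>
lemma phi_div_ge:
  assumes T: "T > 0" "moment_summable_at T" and t: "t > 0" "summable_at t"
    and crit: "excess T = w 0 \<or> excess T \<le> w 0 \<and> t \<le> T"
  shows "phi T / T \<le> phi t / t"
proof -
  have sT: "summable_at T" using T by (intro summable_at_if_moment) auto
  define l where "l = ln (t / T)"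
  \<comment> \<open>If \<open>excess T < w 0\<close>, then \<open>t <= T\<close> and both factors
    are nonpositive. The product is the first-order term
    \<open>l * (moment T - phi T)\<close>.\<close>
  have "0 \<le> l * (excess T - w 0)"
  proof (cases "excess T = w 0")
    case False
    then have "l \<le> 0" using crit T t by (simp add: l_def)
    then show ?thesis using crit by (intro mult_nonpos_nonpos) auto
  qed simp
  then have "phi T \<le> phi T + l * (moment T - phi T)"
    using excess_eq[of T] T by simp
  also have "\<dots> = (\<Sum>k. w k * T ^ k + l * (real k * w k * T ^ k - w k * T ^ k))"
    unfolding phi_def moment_def
    by (intro sums_unique sums_add sums_mult sums_diff summable_sums T sT)
  also have "\<dots> \<le> (\<Sum>k. T / t * (w k * t ^ k))"
  proof (rule suminf_le)
    show "summable (\<lambda>k. w k * T ^ k + l * (real k * w k * T ^ k - w k * T ^ k))"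
      by (intro summable_add summable_mult summable_diff T sT)
    show "summable (\<lambda>k. T / t * (w k * t ^ k))" by (intro summable_mult t)
    fix k
    have "1 + (real k - 1) * l \<le> exp ((real k - 1) * l)" by (rule exp_ge_add_one_self)
    also have "\<dots> = (t / T) ^ k / (t / T)"
      using T t by (simp add: left_diff_distrib exp_diff exp_of_nat_mult l_def)
    finally have "w k * T ^ k * (1 + (real k - 1) * l) \<le> w k * T ^ k * ((t / T) ^ k / (t / T))"
      using T by (intro mult_left_mono term_nonneg) auto
    also have "\<dots> = T / t * (w k * t ^ k)"
      using T t by (simp add: power_divide)
    finally show "w k * T ^ k + l * (real k * w k * T ^ k - w k * T ^ k) \<le> T / t * (w k * t ^ k)"
      by (simp add: algebra_simps)
  qed
  also have "\<dots> = T / t * phi t" unfolding phi_def by (intro suminf_mult t)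
  finally show ?thesis using T t by (simp add: field_simps)
qed

section \<open>The growth rate\<close>

lemma excess_0: "excess 0 = 0"
  unfolding excess_def by (subst suminf_finite[of "{}"]) (auto simp: power_0_left)

lemma excess_inject:
  assumes "0 \<le> s" "0 \<le> t" "moment_summable_at s" "moment_summable_at t" "excess s = excess t"
  shows "s = t"
  using excess_strict_mono[of s t] excess_strict_mono[of t s] assms
  by (cases s t rule: linorder_cases) auto

lemma moment_summable_at_if_Psi_eq_1:
  assumes "t \<ge> 0" "summable_at t" "Psi w t = 1"
  shows "moment_summable_at t"
  using Psi_eq_top[OF assms(1,2)] assms(3) by fastforce

lemma nu_eq_Psi:
  assumes "rho w = ereal R" "R \<ge> 0" "summable_at R"
  shows "nu w = Psi w R"
  using assms Phi_finite_iff[of R] by (simp add: nu_def)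

text \<open>Where the moments converge, \<open>excess\<close> settles the question; the work is at
  the endpoint, where \<open>PsiX\<close> is \<open>nu w\<close>.\<close>

lemma critical_point_properties:
  assumes T: "T \<ge> 0" "moment_summable_at T" "excess T = w 0"
  shows "nu w \<ge> 1"
    and "0 \<le> t \<and> ereal t \<le> rho w \<and> PsiX w t = 1 \<longleftrightarrow> t = T"
proof -
  have PsiT: "Psi w T = 1" using T Psi_eq_1_iff by blast
  have sT: "summable_at T" using T summable_at_if_moment by blast
  have Tle: "ereal T \<le> rho w" using T sT le_rho by blast
  show nu: "nu w \<ge> 1"
  proof (cases "rho w = \<infinity> \<or> Phi w (real_of_ereal (rho w)) = \<infinity>")
    case True
    \<comment> \<open>\<open>Phi\<close> converges at the finite point \<open>T\<close>, so
      \<open>T\<close> lies strictly below the endpoint and \<open>Psi w T = 1\<close> is at most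
      \<open>nu w\<close>.\<close>
    then have "ereal T \<noteq> rho w" using Phi_finite_iff[OF T(1)] sT by (auto dest: sym)
    then show ?thesis using Psi_le_nu[OF T(1) _ True] Tle PsiT by simp
  next
    case False
    then obtain R where R: "rho w = ereal R" using Tle by (cases "rho w") auto
    have "T \<le> R" using R Tle by simp
    then have "R \<ge> 0" using T by simp
    have sR: "summable_at R" using False R Phi_finite_iff[OF \<open>R \<ge> 0\<close>] by simp
    have "\<not> Psi w R < 1"
    proof (cases "moment_summable_at R")
      case True
      then have "excess R \<ge> w 0"
        using excess_strict_mono[OF T(1) _ True] T(3) \<open>T \<le> R\<close> by (cases "T = R") auto
      then show ?thesis using Psi_less_1_iff[OF \<open>R \<ge> 0\<close> True] by simp
    qed (simp add: Psi_eq_top[OF \<open>R \<ge> 0\<close> sR])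
    then show ?thesis using nu_eq_Psi[OF R \<open>R \<ge> 0\<close> sR] by simp
  qed
  show "0 \<le> t \<and> ereal t \<le> rho w \<and> PsiX w t = 1 \<longleftrightarrow> t = T"
  proof
    assume "t = T"
    then show "0 \<le> t \<and> ereal t \<le> rho w \<and> PsiX w t = 1"
      using T(1) Tle PsiT nu_eq_Psi[OF _ T(1) sT] by (auto simp: PsiX_def)
  next
    assume t: "0 \<le> t \<and> ereal t \<le> rho w \<and> PsiX w t = 1"
    have "summable_at t \<and> Psi w t = 1"
    proof (cases "ereal t = rho w")
      case False
      then show ?thesis using t summable_at_less_rho[of t] by (simp add: PsiX_def less_le)
    next
      case True
      then have "nu w = 1" using t by (simp add: PsiX_def)
      have "summable_at t"
      proof (rule ccontr)
        assume n: "\<not> summable_at t"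
        \<comment> \<open>With \<open>Phi\<close> divergent at the endpoint \<open>t\<close>, a
          point \<open>u\<close> between \<open>T\<close> and \<open>t\<close> has
          \<open>Psi w u > 1 = nu w\<close>, against \<open>Psi_le_nu\<close>.\<close>
        then have "T < t" using sT Tle[folded True] by (cases "T = t") auto
        then obtain u where u: "T < u" "u < t" using dense by blast
        then have mu: "moment_summable_at u"
          using T(1) True by (intro moment_summable_at_less_rho) (auto simp flip: True)
        have "Psi w u \<le> 1"
          unfolding \<open>nu w = 1\<close>[symmetric]
          using u T(1) t n Phi_finite_iff[of t] by (intro Psi_le_nu) (auto simp flip: True)
        moreover have "excess u > w 0" using excess_strict_mono[OF T(1) u(1) mu] T(3) by simp
        ultimately show False
          using Psi_less_1_iff[OF _ mu] Psi_eq_1_iff[OF _ mu] u T(1) by (auto simp: le_less)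
      qed
      then show ?thesis using nu_eq_Psi[of t] True t \<open>nu w = 1\<close> by simp
    qed
    moreover from this have mt: "moment_summable_at t"
      using t moment_summable_at_if_Psi_eq_1 by blast
    ultimately have "excess t = w 0" using t Psi_eq_1_iff by blast
    then show "t = T" using excess_inject[OF _ T(1) mt T(2)] t T(3) by simp
  qed
qed

text \<open>\<open>Phi\<close> converges at the endpoint \<open>T\<close>, so \<open>nu w\<close> is
  the value \<open>Psi w T\<close> rather than a limit.\<close>

lemma nu_less_1:
  assumes "T \<ge> 0" "moment_summable_at T" "excess T < w 0" "rho w = ereal T"
  shows "nu w < 1"
  using nu_eq_Psi[OF assms(4,1)] Psi_less_1_iff[OF assms(1,2)] summable_at_if_moment[OF assms(1,2)] assms(3)
  by simp

lemma tau_eq: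
  assumes "T \<ge> 0" "moment_summable_at T" "excess T = w 0 \<or> excess T < w 0 \<and> rho w = ereal T"
  shows "tau w = ereal T"
  using assms(3)
proof
  assume "excess T = w 0"
  then show ?thesis
    using critical_point_properties[OF assms(1,2)] by (simp add: tau_def)
next
  assume "excess T < w 0 \<and> rho w = ereal T"
  moreover from this have "\<not> nu w \<ge> 1" using nu_less_1[OF assms(1,2)] by (simp add: not_le)
  ultimately show ?thesis by (simp only: tau_def if_False)
qed

text \<open>An intermediate exponent \<open>c\<close> leaves two gaps: \<open>c < b\<close> feeds
  \<open>Z_ge_geometric\<close>, and \<open>a < c\<close> absorbs the vanishing
  \<open>ln K / n\<close>. Both the finite and the infinite limit rest on this bound.\<close>

lemma eventually_less_ln_Z:
  assumes "a < b" "\<And>t. t > 0 \<Longrightarrow> \<exists>K. exp b * t < (\<Sum>k\<le>K. w k * t ^ k)"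
  shows "\<forall>\<^sub>F n in sequentially. n mod span w = 1 mod span w \<longrightarrow> Z w n > 0 \<and> a < ln (Z w n) / real n"
proof -
  obtain c where c: "a < c" "c < b" using dense[OF assms(1)] by blast
  obtain K where K: "K > 0"
    "\<forall>\<^sub>F n in sequentially. n mod span w = 1 mod span w \<longrightarrow> K * exp c ^ n \<le> Z w n"
    using Z_ge_geometric[of "exp c" "exp b"] assms(2) c by auto
  have "(\<lambda>n. ln K / real n + c) \<longlonglongrightarrow> 0 + c"
    by (intro tendsto_intros lim_const_over_n)
  then have "\<forall>\<^sub>F n in sequentially. a < ln K / real n + c"
    using c by (intro order_tendstoD) auto
  with K(2) eventually_gt_at_top[of "0::nat"] show ?thesis
  proof eventually_elim
    case (elim n)
    show ?case
    proof
      assume "n mod span w = 1 mod span w"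
      then have le: "K * exp c ^ n \<le> Z w n" using elim by simp
      have pos: "0 < K * exp c ^ n" using K(1) by simp
      have "ln K + n * c = ln (K * exp c ^ n)"
        using K(1) by (simp add: ln_mult ln_realpow)
      also have "\<dots> \<le> ln (Z w n)" using le pos by (intro ln_mono) auto
      finally have "(ln K + n * c) / n \<le> ln (Z w n) / n" by (intro divide_right_mono) auto
      then have "ln K / real n + c \<le> ln (Z w n) / real n"
        using elim(2) by (simp add: add_divide_distrib)
      then show "Z w n > 0 \<and> a < ln (Z w n) / real n" using elim le pos by linarith
    qed
  qed
qed

lemma ln_Z_le:
  assumes "T > 0" "summable_at T" "Z w n > 0" "n > 0"
  shows "ln (Z w n) / real n \<le> ln T / real n + (ln (phi T) - ln T)"
proof -
  have p: "phi T > 0" using phi_pos assms by simp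
  have "Z w n \<le> T * (phi T / T) ^ n"
    using assms p sum_le_phi[of T] by (intro Z_le_geometric) auto
  then have "ln (Z w n) \<le> ln (T * (phi T / T) ^ n)" using assms by (intro ln_mono) auto
  also have "\<dots> = ln T + n * (ln (phi T) - ln T)"
    using assms p by (simp add: ln_mult ln_realpow ln_div)
  finally show ?thesis using assms by (simp add: field_simps)
qed

text \<open>In \<open>ennreal\<close> a positive value divided by zero is infinite, so including
  \<open>t = 0\<close> leaves the infimum unchanged.\<close>

lemma Phi_0_divide: "Phi w 0 / ennreal 0 = top"
proof -
  have s: "summable_at 0" by (rule summable_finite[of "{0}"]) (auto simp: power_0_left)
  show ?thesis using Phi_eq[OF _ s] phi_pos[OF _ s] by (simp add: ennreal_divide_zero)
qed

lemma Phi_divide_eq_top: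
  assumes "t \<ge> 0" "\<not> summable_at t"
  shows "Phi w t / ennreal t = top"
  using Phi_finite_iff[OF assms(1)] assms(2) by (simp add: ennreal_top_divide)

lemma INF_Phi_divide:
  assumes "T > 0" "moment_summable_at T" "excess T = w 0 \<or> excess T < w 0 \<and> rho w = ereal T"
  shows "(INF t\<in>{0::real..}. Phi w t / ennreal t) = ennreal (phi T / T)"
proof (rule antisym)
  have eq: "Phi w t / ennreal t = ennreal (phi t / t)" if "t > 0" "summable_at t" for t
    using that Phi_eq[of t] phi_pos[of t] by (simp add: divide_ennreal)
  have sT: "summable_at T" using assms by (intro summable_at_if_moment) auto
  show "(INF t\<in>{0::real..}. Phi w t / ennreal t) \<le> ennreal (phi T / T)"
    unfolding eq[OF assms(1) sT, symmetric] using assms(1) by (intro INF_lower) auto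
  show "ennreal (phi T / T) \<le> (INF t\<in>{0::real..}. Phi w t / ennreal t)"
  proof (rule INF_greatest)
    fix t :: real assume "t \<in> {0..}"
    then consider "t = 0" | "t > 0" "\<not> summable_at t" | "t > 0" "summable_at t" by fastforce
    then show "ennreal (phi T / T) \<le> Phi w t / ennreal t"
    proof cases
      case 3
      \<comment> \<open>When \<open>rho w = T\<close>, the bound \<open>t <= T\<close> required by
        \<open>phi_div_ge\<close> comes from \<open>le_rho\<close>.\<close>
      then have "phi T / T \<le> phi t / t"
        using assms le_rho[of t] by (intro phi_div_ge) auto
      then show ?thesis unfolding eq[OF 3] by (rule ennreal_leI)
    next
      case 1
      then show ?thesis by (simp only: Phi_0_divide top_greatest)
    next
      case 2
      then show ?thesis by (simp add: Phi_divide_eq_top)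
    qed
  qed
qed

text \<open>As \<open>phi T / T\<close> is the minimum, for \<open>b < L\<close> no
  \<open>t > 0\<close> bounds all partial sums by \<open>exp b * t\<close>, which gives the lower
  bound; the upper one is \<open>ln_Z_le\<close>.\<close>

lemma ln_Z_tendsto:
  assumes T: "T > 0" "moment_summable_at T" "excess T = w 0 \<or> excess T < w 0 \<and> rho w = ereal T"
  shows "((\<lambda>n. ln (Z w n) / real n) \<longlongrightarrow> ln (phi T) - ln T)
           (inf sequentially (principal {n. n mod span w = 1 mod span w}))"
proof -
  define L where "L = ln (phi T) - ln T"
  have sT: "summable_at T" using T by (intro summable_at_if_moment) auto
  have p: "phi T > 0" using phi_pos T sT by simp
  have expL: "exp L = phi T / T" using p T(1) by (simp add: L_def exp_diff)
  have lower: "\<forall>\<^sub>F n in sequentially. n mod span w = 1 mod span w \<longrightarrow> Z w n > 0 \<and> a < ln (Z w n) / real n"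
    if "a < L" for a
  proof -
    obtain b where b: "a < b" "b < L" using dense[OF \<open>a < L\<close>] by blast
    show ?thesis
    proof (rule eventually_less_ln_Z[OF b(1)], rule ccontr)
      fix t :: real assume "t > 0" and "\<nexists>K. exp b * t < (\<Sum>k\<le>K. w k * t ^ k)"
      then have le: "(\<Sum>k\<le>K. w k * t ^ k) \<le> exp b * t" for K using not_le by blast
      have st: "summable_at t" and "phi t \<le> exp b * t"
        using summable_at_of_bounded[OF _ le] \<open>t > 0\<close> by auto
      then have "phi t / t \<le> exp b" using \<open>t > 0\<close> by (simp add: field_simps)
      moreover have "phi T / T \<le> phi t / t"
        using T \<open>t > 0\<close> st le_rho[of t] by (intro phi_div_ge) auto
      moreover have "exp b < exp L" using b by simp
      ultimately show False using expL by simp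
    qed
  qed
  have "((\<lambda>n. ln (Z w n) / real n) \<longlongrightarrow> L) (inf sequentially (principal {n. n mod span w = 1 mod span w}))"
  proof (rule order_tendstoI)
    fix a assume "a < L"
    then show "\<forall>\<^sub>F n in inf sequentially (principal {n. n mod span w = 1 mod span w}). a < ln (Z w n) / real n"
      unfolding eventually_inf_principal using lower[of a] by (auto elim: eventually_mono)
  next
    fix a assume "L < a"
    have "(\<lambda>n. ln T / real n + L) \<longlonglongrightarrow> 0 + L" by (intro tendsto_intros lim_const_over_n)
    then have "\<forall>\<^sub>F n in sequentially. ln T / real n + L < a"
      using \<open>L < a\<close> by (intro order_tendstoD) auto
    \<comment> \<open>\<open>ln_Z_le\<close> asks for \<open>Z w n > 0\<close>; the lower bound at
      any level below \<open>L\<close> provides it.\<close>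
    moreover have "\<forall>\<^sub>F n in sequentially. n mod span w = 1 mod span w \<longrightarrow> Z w n > 0"
      using lower[of "L - 1"] by (auto elim: eventually_mono)
    ultimately have "\<forall>\<^sub>F n in sequentially. n mod span w = 1 mod span w \<longrightarrow> ln (Z w n) / real n < a"
      using eventually_gt_at_top[of "0::nat"]
    proof eventually_elim
      case (elim n)
      then show ?case using ln_Z_le[OF T(1) sT, of n] unfolding L_def by auto
    qed
    then show "\<forall>\<^sub>F n in inf sequentially (principal {n. n mod span w = 1 mod span w}). ln (Z w n) / real n < a"
      by (simp add: eventually_inf_principal)
  qed
  then show ?thesis by (simp add: L_def)
qed

lemma not_summable_at_of_rho_0:
  assumes "rho w = 0" "t > 0"
  shows "\<not> summable_at t"
  using le_rho[of t] assms by auto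

text \<open>With radius of convergence zero, the partial sums are unbounded at every
  \<open>t > 0\<close>, so every exponent is admissible.\<close>

lemma ln_Z_at_top:
  assumes "rho w = 0"
  shows "filterlim (\<lambda>n. ln (Z w n) / real n) at_top
           (inf sequentially (principal {n. n mod span w = 1 mod span w}))"
  unfolding filterlim_at_top_dense
proof
  fix a :: real
  have "\<forall>\<^sub>F n in sequentially. n mod span w = 1 mod span w \<longrightarrow> Z w n > 0 \<and> a < ln (Z w n) / real n"
  proof (rule eventually_less_ln_Z[of a "a + 1"], simp, rule ccontr)
    fix t :: real assume "t > 0" and "\<nexists>K. exp (a + 1) * t < (\<Sum>k\<le>K. w k * t ^ k)"
    then have "\<And>K. (\<Sum>k\<le>K. w k * t ^ k) \<le> exp (a + 1) * t" using not_le by blast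
    then have "summable_at t" using summable_at_of_bounded(1) \<open>t > 0\<close> less_imp_le by blast
    then show False using not_summable_at_of_rho_0[OF assms \<open>t > 0\<close>] by simp
  qed
  then show "\<forall>\<^sub>F n in inf sequentially (principal {n. n mod span w = 1 mod span w}). a < ln (Z w n) / real n"
    unfolding eventually_inf_principal by (auto elim: eventually_mono)
qed

end

theorem theorem17p6:
  fixes w :: "nat \<Rightarrow> real"
  assumes nonneg: "\<And>k. w k \<ge> 0"
    and w0: "w 0 > 0"
    and wk: "\<exists>k\<ge>2. w k > 0"
  defines "F \<equiv> inf sequentially (principal {n. n mod span w = 1 mod span w})"
  shows "(nu w \<ge> 1 \<longrightarrow> (\<exists>!t. 0 \<le> t \<and> ereal t \<le> rho w \<and> PsiX w t = 1))
    \<and> (rho w > 0 \<longrightarrow>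
        (\<exists>L::real. ((\<lambda>n. ln (Z w n) / real n) \<longlongrightarrow> L) F
           \<and> (\<exists>t0::real. t0 > 0 \<and> tau w = ereal t0 \<and> Phi w t0 < \<infinity>
                 \<and> L = ln (enn2real (Phi w t0)) - ln t0)
           \<and> (INF t\<in>{0::real..}. Phi w t / ennreal t) = ennreal (exp L)))
    \<and> (rho w = 0 \<longrightarrow>
        filterlim (\<lambda>n. ln (Z w n) / real n) at_top F
        \<and> tau w = 0
        \<and> (INF t\<in>{0::real..}. Phi w t / ennreal t) = \<infinity>)"
proof -
  interpret weight_sequence w using assms by unfold_locales auto
  obtain T where T: "T \<ge> 0" "moment_summable_at T"
    and crit: "excess T = w 0 \<or> excess T < w 0 \<and> rho w = ereal T"
    using ex_critical_point by blast
  have tau: "tau w = ereal T" by (rule tau_eq[OF T crit])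
  have sT: "summable_at T" by (rule summable_at_if_moment[OF T])
  have p: "phi T > 0" by (rule phi_pos[OF T(1) sT])
  show ?thesis
  proof (intro conjI impI)
    assume "nu w \<ge> 1"
    then have "excess T = w 0" using crit nu_less_1[OF T] by (auto simp: not_le)
    then show "\<exists>!t. 0 \<le> t \<and> ereal t \<le> rho w \<and> PsiX w t = 1"
      using critical_point_properties(2)[OF T] by simp
  next
    assume rho: "rho w > 0"
    \<comment> \<open>At \<open>T = 0\<close> the excess is \<open>0 < w 0\<close>, so
      \<open>crit\<close> would force \<open>rho w = 0\<close>.\<close>
    have "T \<noteq> 0" using crit rho excess_0 w0 by auto
    then have "T > 0" using T by simp
    then have "exp (ln (phi T) - ln T) = phi T / T" using p by (simp add: exp_diff)
    moreover have "Phi w T < \<infinity>" "enn2real (Phi w T) = phi T"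
      using Phi_eq[OF T(1) sT] p by (simp_all add: less_top)
    ultimately show "\<exists>L::real. ((\<lambda>n. ln (Z w n) / real n) \<longlongrightarrow> L) F
           \<and> (\<exists>t0::real. t0 > 0 \<and> tau w = ereal t0 \<and> Phi w t0 < \<infinity>
                 \<and> L = ln (enn2real (Phi w t0)) - ln t0)
           \<and> (INF t\<in>{0::real..}. Phi w t / ennreal t) = ennreal (exp L)"
      using ln_Z_tendsto[OF \<open>T > 0\<close> T(2) crit] INF_Phi_divide[OF \<open>T > 0\<close> T(2) crit] tau \<open>T > 0\<close>
      unfolding F_def by (intro exI[of _ "ln (phi T) - ln T"] conjI exI[of _ T]) auto
  next
    assume rho: "rho w = 0"
    show "filterlim (\<lambda>n. ln (Z w n) / real n) at_top F"
      unfolding F_def by (rule ln_Z_at_top[OF rho])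
    show "tau w = 0" using tau le_rho[OF T(1) sT] T(1) rho by (simp add: zero_ereal_def)
    have "Phi w t / ennreal t = top" if "t \<in> {0..}" for t
      using that Phi_0_divide Phi_divide_eq_top[of t] not_summable_at_of_rho_0[OF rho, of t]
      by (cases "t = 0") auto
    then show "(INF t\<in>{0::real..}. Phi w t / ennreal t) = \<infinity>" by simp
  qed
qed

end
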